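(* Let $K$ be a compact Hausdorff space and let $[f,g]$ be an interval in canonical representation in $C(K)$. (Necessity) If $[f,g]$ has a square root which is an interval, then $g\ge 0$ and $|f|\le g$ pointwise on $K$. (Sufficiency) If $g$ is continuous and $-g\le f\le 0<g$ pointwise on $K$, then $[f,g]$ has a square root which is an interval.
   Context: $C(K)$ is the Banach algebra of continuous real functions on $K$ with the supremum norm. For $A,B\subset C(K)$, $A\cdot B=\{ab: a\in A,\ b\in B\}$ with pointwise products. An interval in $C(K)$ is a set of the form $[f,g]=\{h\in C(K): f\le h\le g\}$, where $f,g:K\to\mathbb{R}$ are bounded functions (not necessarily continuous) and inequalities between functions are pointwise. The interval $[f,g]$ is in canonical representation if $f$ is upper semicontinuous, $g$ is lower semicontinuous and $f\le g$. A convex body in $C(K)$ is a nonempty bounded closed convex subset of $C(K)$. A convex body $C$ is a square root of the interval $[f,g]$ if $C\cdot C=[f,g]$. *)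

theory Defs
  imports "HOL-Analysis.Analysis" "HOL-Library.Set_Algebras"
begin

(* C(K) is the type of bounded continuous functions 'k \<Rightarrow>\<^sub>C real with its supremum
   norm, where K is the universe of a type 'k :: t2_space with compact (UNIV :: 'k set).
   The library leaves this type without a product; with the pointwise product below,
   A * B on sets is the product of sets from HOL-Library.Set_Algebras. *)

instantiation bcontfun :: (topological_space, real_normed_algebra) times
begin

definition times_bcontfun ::
  "('a \<Rightarrow>\<^sub>C 'b) \<Rightarrow> ('a \<Rightarrow>\<^sub>C 'b) \<Rightarrow> 'a \<Rightarrow>\<^sub>C 'b" where
  "times_bcontfun a b = Bcontfun (\<lambda>x. a x * b x)"

instance ..

end

lemma apply_bcontfun_times:
  fixes a b :: "'a::topological_space \<Rightarrow>\<^sub>C 'b::real_normed_algebra"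
  shows "apply_bcontfun (a * b) x = a x * b x"
proof -
  obtain M where M: "\<And>x. norm (a x) \<le> M"
    using bounded_apply_bcontfun[of a] by (auto simp: bounded_iff)
  obtain N where N: "\<And>x. norm (b x) \<le> N"
    using bounded_apply_bcontfun[of b] by (auto simp: bounded_iff)
  have "norm (a x * b x) \<le> M * N" for x
    by (meson M N mult_mono norm_ge_zero norm_mult_ineq order_trans)
  then have "bounded (range (\<lambda>x. a x * b x))"
    by (auto simp: bounded_iff)
  moreover have "continuous_on UNIV (\<lambda>x. a x * b x)"
    by (intro continuous_intros) auto
  ultimately show ?thesis
    by (simp add: times_bcontfun_def bcontfun_def Bcontfun_inverse)
qed

definition upper_semicontinuous :: "('k::topological_space \<Rightarrow> real) \<Rightarrow> bool" where
  "upper_semicontinuous f \<longleftrightarrow> (\<forall>c. open {x. f x < c})"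

definition lower_semicontinuous :: "('k::topological_space \<Rightarrow> real) \<Rightarrow> bool" where
  "lower_semicontinuous f \<longleftrightarrow> (\<forall>c. open {x. c < f x})"

(* The inequalities are those of the pointwise order on functions. *)
definition fun_interval ::
  "('k::topological_space \<Rightarrow> real) \<Rightarrow> ('k \<Rightarrow> real) \<Rightarrow> ('k \<Rightarrow>\<^sub>C real) set" where
  "fun_interval f g = {h. f \<le> apply_bcontfun h \<and> apply_bcontfun h \<le> g}"

(* The endpoints are arbitrary bounded functions: neither semicontinuous nor ordered. *)
definition is_fun_interval :: "('k::topological_space \<Rightarrow>\<^sub>C real) set \<Rightarrow> bool" where
  "is_fun_interval S \<longleftrightarrow>
     (\<exists>f g. bounded (range f) \<and> bounded (range g) \<and> S = fun_interval f g)"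

definition canonical_representation ::
  "('k::topological_space \<Rightarrow> real) \<Rightarrow> ('k \<Rightarrow> real) \<Rightarrow> bool" where
  "canonical_representation f g \<longleftrightarrow>
     bounded (range f) \<and> bounded (range g) \<and>
     upper_semicontinuous f \<and> lower_semicontinuous g \<and> f \<le> g"

definition convex_body :: "'v::real_normed_vector set \<Rightarrow> bool" where
  "convex_body C \<longleftrightarrow> C \<noteq> {} \<and> bounded C \<and> closed C \<and> convex C"

definition is_square_root ::
  "('k::topological_space \<Rightarrow>\<^sub>C real) set \<Rightarrow> ('k \<Rightarrow>\<^sub>C real) set \<Rightarrow> bool" where
  "is_square_root C S \<longleftrightarrow> convex_body C \<and> C * C = S"

end

theory Submission
  imports Defs
begin

text \<open>
  Necessity: with \<open>a, b \<in> C\<close> also \<open>a\<^sup>2, b\<^sup>2 \<in> C \<cdot> C = [f, g]\<close>, so every \<open>h = a b\<close> in \<open>[f, g]\<close>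
  satisfies \<open>\<bar>h\<bar> \<le> max a\<^sup>2 b\<^sup>2 \<le> g\<close>. Upper semicontinuity of \<open>f\<close> and a Urysohn function let one
  push some member of the nonempty interval down to any level above \<open>f x\<close> at a given point \<open>x\<close>,
  whence \<open>- f x \<le> g x\<close>.
  Sufficiency: with \<open>s = sqrt g\<close>, the interval \<open>[f / s, s]\<close> is a square root, because
  \<open>h = (h / s) \<cdot> s\<close> for every \<open>h \<in> [f, g]\<close>.
\<close>

lemma mem_fun_interval:
  "h \<in> fun_interval f g \<longleftrightarrow> (\<forall>x. f x \<le> apply_bcontfun h x \<and> apply_bcontfun h x \<le> g x)"
  by (auto simp: fun_interval_def le_fun_def)

text \<open>Continuous functions on a compact space are bounded, so a pointwise formula can be
  turned into a member of C(K).\<close>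

lemma obtain_bcontfun:
  fixes u :: "'k::topological_space \<Rightarrow> 'b::metric_space"
  assumes "compact (UNIV :: 'k set)" "continuous_on UNIV u"
  obtains h where "apply_bcontfun h = u"
proof -
  have "u \<in> bcontfun"
    using assms by (simp add: bcontfun_def compact_continuous_image compact_imp_bounded)
  then show thesis
    by (metis bcontfunE that)
qed

text \<open>Norm convergence is uniform convergence, hence pointwise.\<close>

lemma continuous_on_bcontfun_eval: "continuous_on S (\<lambda>h. apply_bcontfun h x)"
  unfolding continuous_on_def
  by (intro ballI tendsto_uniform_limitI[OF tendsto_bcontfun_uniform_limit] tendsto_ident_at UNIV_I)

lemma closed_fun_interval: "closed (fun_interval f g)"
  unfolding fun_interval_def le_fun_def
  by (intro closed_Collect_conj closed_Collect_all closed_Collect_le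
      continuous_on_bcontfun_eval continuous_on_const)

lemma convex_fun_interval: "convex (fun_interval f g)"
proof (rule convexI)
  fix a b and u v :: real
  assume a: "a \<in> fun_interval f g" and b: "b \<in> fun_interval f g"
    and uv: "0 \<le> u" "0 \<le> v" "u + v = 1"
  have "(u *\<^sub>R a + v *\<^sub>R b) x \<in> {f x..g x}" for x
    using convexD[OF convex_real_interval(5), of "a x" "f x" "g x" "b x" u v] a b uv
    by (auto simp: mem_fun_interval)
  then show "u *\<^sub>R a + v *\<^sub>R b \<in> fun_interval f g"
    by (auto simp: mem_fun_interval)
qed

lemma bounded_fun_interval:
  assumes "bounded (range f)" "bounded (range g)"
  shows "bounded (fun_interval f g)"
proof -
  obtain M N where M: "\<And>x. \<bar>f x\<bar> \<le> M" and N: "\<And>x. \<bar>g x\<bar> \<le> N"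
    using assms by (auto simp: bounded_iff)
  have "norm h \<le> M + N" if "h \<in> fun_interval f g" for h
  proof (rule norm_bound)
    fix x
    have "f x \<le> h x" "h x \<le> g x"
      using that by (auto simp: mem_fun_interval)
    then show "norm (h x) \<le> M + N"
      using M[of x] N[of x] by simp
  qed
  then show ?thesis
    by (auto simp: bounded_iff)
qed

lemma convex_body_fun_interval:
  assumes "bounded (range f)" "bounded (range g)" "fun_interval f g \<noteq> {}"
  shows "convex_body (fun_interval f g)"
  using assms
  by (simp add: convex_body_def closed_fun_interval convex_fun_interval bounded_fun_interval)

text \<open>Truncating a member at height \<open>c\<close> respects the lower bound only where
  \<open>f\<close> is at most \<open>c\<close>. The truncation is therefore made near
  \<open>x\<close> and faded out by a Urysohn function.\<close>

lemma fun_interval_below_at_point: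
  fixes f g :: "'k::t2_space \<Rightarrow> real"
  assumes K: "compact (UNIV :: 'k set)" and f: "upper_semicontinuous f"
    and ne: "fun_interval f g \<noteq> {}" and c: "f x < c"
  obtains h where "h \<in> fun_interval f g" "apply_bcontfun h x \<le> c"
proof -
  obtain h0 where h0: "h0 \<in> fun_interval f g"
    using ne by blast
  \<comment> \<open>Compact Hausdorff spaces are normal, hence completely regular; upper
    semicontinuity makes the complement of \<open>{y. f y < c}\<close> a closed set missing
    \<open>x\<close>.\<close>
  have "Hausdorff_space (euclidean :: 'k topology)"
    unfolding Hausdorff_space_def disjnt_def by (simp add: separation_t2)
  then have "completely_regular_space (euclidean :: 'k topology)"
    using K by (intro normal_imp_completely_regular_space
        compact_Hausdorff_or_regular_imp_normal_space) (auto simp: compact_space_def)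
  moreover have "closedin euclidean (- {y. f y < c})" "x \<in> topspace euclidean - (- {y. f y < c})"
    using f c by (auto simp: upper_semicontinuous_def)
  ultimately obtain \<phi> :: "'k \<Rightarrow> real"
    where "continuous_map euclidean (top_of_set {0..1}) \<phi>"
      and x: "\<phi> x = 0" and off: "\<phi> ` (- {y. f y < c}) \<subseteq> {1}"
    unfolding completely_regular_space_def by meson
  then have cont: "continuous_on UNIV \<phi>" and range: "\<And>y. \<phi> y \<in> {0..1}"
    by (auto simp: continuous_map_in_subtopology)
  \<comment> \<open>The blend is the truncation \<open>min (h0 x) c\<close> at \<open>x\<close>, and
    \<open>h0\<close> itself wherever truncating could violate the lower bound.\<close>
  have "continuous_on UNIV (\<lambda>y. \<phi> y * h0 y + (1 - \<phi> y) * min (h0 y) c)"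
    by (intro continuous_intros cont continuous_on_apply_bcontfun)
  then obtain h where h: "apply_bcontfun h = (\<lambda>y. \<phi> y * h0 y + (1 - \<phi> y) * min (h0 y) c)"
    using obtain_bcontfun[OF K] by blast
  have "f y \<le> h y \<and> h y \<le> g y" for y
  proof (cases "f y < c")
    case True
    have "convex {f y..g y}" "h0 y \<in> {f y..g y}" "min (h0 y) c \<in> {f y..g y}"
      using True h0 by (auto simp: mem_fun_interval min_le_iff_disj)
    then have "\<phi> y *\<^sub>R h0 y + (1 - \<phi> y) *\<^sub>R min (h0 y) c \<in> {f y..g y}"
      using range[of y] by (intro convexD) auto
    then show ?thesis
      by (simp add: h)
  next
    case False
    then have "\<phi> y = 1"
      using off by auto
    then show ?thesis
      using h0 by (simp add: h mem_fun_interval)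
  qed
  then show thesis
    by (intro that[of h]) (auto simp: mem_fun_interval h x)
qed

lemma abs_mult_le_of_squares_le:
  fixes a b :: "'a::linordered_idom"
  assumes "a * a \<le> c" "b * b \<le> c"
  shows "\<bar>a * b\<bar> \<le> c"
proof (cases "\<bar>a\<bar> \<le> \<bar>b\<bar>")
  case True
  then have "\<bar>a\<bar> * \<bar>b\<bar> \<le> \<bar>b\<bar> * \<bar>b\<bar>"
    by (intro mult_right_mono) auto
  then show ?thesis
    using assms by (simp add: abs_mult)
next
  case False
  then have "\<bar>a\<bar> * \<bar>b\<bar> \<le> \<bar>a\<bar> * \<bar>a\<bar>"
    by (intro mult_left_mono) auto
  then show ?thesis
    using assms by (simp add: abs_mult)
qed

lemma square_root_imp_abs_le:
  assumes root: "C * C = fun_interval f g" and h: "h \<in> fun_interval f g"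
  shows "\<bar>apply_bcontfun h x\<bar> \<le> g x"
proof -
  obtain a b where ab: "a \<in> C" "b \<in> C" "h = a * b"
    using h root by (metis set_times_elim)
  have "a * a \<in> fun_interval f g" "b * b \<in> fun_interval f g"
    using ab root by (metis set_times_intro)+
  then have "a x * a x \<le> g x" "b x * b x \<le> g x"
    by (auto simp: mem_fun_interval apply_bcontfun_times)
  then show ?thesis
    by (simp add: ab apply_bcontfun_times abs_mult_le_of_squares_le)
qed

lemma square_root_necessary:
  fixes f g :: "'k::t2_space \<Rightarrow> real"
  assumes K: "compact (UNIV :: 'k set)" and f: "upper_semicontinuous f" and fg: "f \<le> g"
    and C: "is_square_root C (fun_interval f g)"
  shows "\<bar>f x\<bar> \<le> g x"
proof -
  have root: "C * C = fun_interval f g" and "C \<noteq> {}"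
    using C by (auto simp: is_square_root_def convex_body_def)
  \<comment> \<open>Products of members of \<open>C\<close> supply a member, so no insertion theorem
    for semicontinuous functions is called for.\<close>
  then have ne: "fun_interval f g \<noteq> {}"
    by (metis ex_in_conv set_times_intro)
  \<comment> \<open>Members of the interval may fail to attain \<open>f x\<close>, so the bound is
    proved at each level above it and passed to the limit.\<close>
  have "- g x \<le> c" if c: "f x < c" for c
  proof -
    obtain h where "h \<in> fun_interval f g" "h x \<le> c"
      using fun_interval_below_at_point[OF K f ne c] by blast
    then show ?thesis
      using square_root_imp_abs_le[OF root, of h x] by linarith
  qed
  then have "- g x \<le> f x"
    by (rule dense_ge)
  then show ?thesis
    using fg by (simp add: le_fun_def abs_le_iff)
qed

text \<open>The pointwise core of sufficiency, with \<open>p\<close> for \<open>f x / s x\<close>.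
  The lower bound is at stake only for factors of opposite sign, the upper one follows from both
  factors being at most \<open>s\<close> in absolute value.\<close>

lemma mult_mem_interval:
  fixes a b s p :: "'a::linordered_idom"
  assumes "- s \<le> p" "p \<le> 0" "0 \<le> s" "p \<le> a" "a \<le> s" "p \<le> b" "b \<le> s"
  shows "p * s \<le> a * b" "a * b \<le> s * s"
proof -
  \<comment> \<open>By symmetry the factors may be ordered; in the mixed case \<open>a\<close> is
    then the negative one.\<close>
  have *: "p * s \<le> a * b" if "a \<le> b" "p \<le> a" "b \<le> s" for a b
  proof (cases "0 \<le> a \<or> b \<le> 0")
    case True
    then have "0 \<le> a * b"
      using that by (auto simp: zero_le_mult_iff)
    then show ?thesis
      using assms mult_nonpos_nonneg[of p s] by simp
  next
    case False
    have "p * s \<le> p * b"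
      using that assms by (intro mult_left_mono_neg)
    also have "\<dots> \<le> a * b"
      using that False by (intro mult_right_mono) auto
    finally show ?thesis .
  qed
  show "p * s \<le> a * b"
    using *[of a b] *[of b a] assms by (cases "a \<le> b") (auto simp: mult.commute)
  have "\<bar>a\<bar> * \<bar>b\<bar> \<le> s * s"
    using assms by (intro mult_mono) auto
  then show "a * b \<le> s * s"
    by (metis abs_le_D1 abs_mult)
qed

lemma square_root_interval:
  fixes f s :: "'k::topological_space \<Rightarrow> real"
  assumes K: "compact (UNIV :: 'k set)" and s: "continuous_on UNIV s"
    and pos: "\<And>x. 0 < s x" and f: "\<And>x. - (s x * s x) \<le> f x" "\<And>x. f x \<le> 0"
  shows "bounded (range (\<lambda>x. f x / s x))" "bounded (range s)"
    and "is_square_root (fun_interval (\<lambda>x. f x / s x) s) (fun_interval f (\<lambda>x. s x * s x))"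
proof -
  let ?p = "\<lambda>x. f x / s x"
  let ?C = "fun_interval ?p s"
  have p: "- s x \<le> ?p x" "?p x \<le> 0" "?p x * s x = f x" for x
    using pos[of x] f[of x] by (auto simp: field_simps)
  show bs: "bounded (range s)"
    using K s by (simp add: compact_continuous_image compact_imp_bounded)
  then obtain M where M: "\<And>x. \<bar>s x\<bar> \<le> M"
    by (auto simp: bounded_iff)
  \<comment> \<open>The quotient lies between \<open>- s x\<close> and 0, so it inherits the bound
    of \<open>s\<close>.\<close>
  have "\<bar>?p x\<bar> \<le> M" for x
    using M[of x] p(1,2)[of x] by linarith
  then show bp: "bounded (range ?p)"
    by (auto simp: bounded_iff)
  obtain \<sigma> where \<sigma>: "apply_bcontfun \<sigma> = s"
    using K s by (rule obtain_bcontfun)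
  \<comment> \<open>This member shows that \<open>?C\<close> is nonempty and serves as the common
    second factor in all factorizations below.\<close>
  have \<sigma>C: "\<sigma> \<in> ?C"
    using p(2) pos unfolding mem_fun_interval \<sigma>
    by (meson less_imp_le order_refl order_trans)
  have "?C * ?C = fun_interval f (\<lambda>x. s x * s x)"
  proof (intro equalityI subsetI)
    fix h assume "h \<in> ?C * ?C"
    then obtain a b where ab: "h = a * b" "a \<in> ?C" "b \<in> ?C"
      by (rule set_times_elim)
    have "f x \<le> a x * b x \<and> a x * b x \<le> s x * s x" for x
      using mult_mem_interval[of "s x" "?p x" "a x" "b x"] p[of x] pos[of x] ab(2,3)
      by (auto simp: mem_fun_interval)
    then show "h \<in> fun_interval f (\<lambda>x. s x * s x)"
      by (simp add: mem_fun_interval ab(1) apply_bcontfun_times)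
  next
    fix h assume h: "h \<in> fun_interval f (\<lambda>x. s x * s x)"
    have nz: "s x \<noteq> 0" for x
      using pos[of x] by simp
    \<comment> \<open>Dividing the bounds on \<open>h\<close> by the positive \<open>s\<close> gives
      exactly the endpoints of \<open>?C\<close>.\<close>
    have "continuous_on UNIV (\<lambda>x. h x / s x)"
      using s nz by (intro continuous_on_divide continuous_on_apply_bcontfun) auto
    then obtain a where a: "apply_bcontfun a = (\<lambda>x. h x / s x)"
      using obtain_bcontfun[OF K] by blast
    have "a \<in> ?C"
      using h pos unfolding mem_fun_interval a
      by (auto simp: divide_right_mono less_imp_le pos_divide_le_eq nz)
    moreover have "h = a * \<sigma>"
      by (rule bcontfun_eqI) (simp add: apply_bcontfun_times a \<sigma> nz)
    ultimately show "h \<in> ?C * ?C"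
      using \<sigma>C by (auto intro: set_times_intro)
  qed
  moreover have "convex_body ?C"
    using bp bs \<sigma>C by (intro convex_body_fun_interval) auto
  ultimately show "is_square_root ?C (fun_interval f (\<lambda>x. s x * s x))"
    by (simp add: is_square_root_def)
qed

theorem proposition5p1:
  fixes f g :: "'k::t2_space \<Rightarrow> real"
  assumes "compact (UNIV :: 'k set)"
    and "canonical_representation f g"
  shows "((\<exists>C. is_fun_interval C \<and> is_square_root C (fun_interval f g)) \<longrightarrow>
            (\<forall>x. 0 \<le> g x \<and> \<bar>f x\<bar> \<le> g x)) \<and>
         (continuous_on UNIV g \<and> (\<forall>x. - g x \<le> f x \<and> f x \<le> 0 \<and> 0 < g x) \<longrightarrow>
            (\<exists>C. is_fun_interval C \<and> is_square_root C (fun_interval f g)))"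
proof (intro conjI impI)
  assume "\<exists>C. is_fun_interval C \<and> is_square_root C (fun_interval f g)"
  then have "\<bar>f x\<bar> \<le> g x" for x
    using assms square_root_necessary by (auto simp: canonical_representation_def)
  then show "\<forall>x. 0 \<le> g x \<and> \<bar>f x\<bar> \<le> g x"
    by (meson abs_ge_zero order_trans)
next
  assume g: "continuous_on UNIV g \<and> (\<forall>x. - g x \<le> f x \<and> f x \<le> 0 \<and> 0 < g x)"
  let ?s = "\<lambda>x. sqrt (g x)"
  have sq: "?s x * ?s x = g x" for x
    using g by (simp add: less_imp_le)
  have "continuous_on UNIV ?s"
    using g by (intro continuous_intros) auto
  then have "bounded (range (\<lambda>x. f x / ?s x))" "bounded (range ?s)"
    "is_square_root (fun_interval (\<lambda>x. f x / ?s x) ?s) (fun_interval f (\<lambda>x. ?s x * ?s x))"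
    using square_root_interval[OF assms(1), of ?s f] g sq by auto
  then show "\<exists>C. is_fun_interval C \<and> is_square_root C (fun_interval f g)"
    unfolding is_fun_interval_def sq by blast
qed

end
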